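(* Let $n\ge 1$ be an integer, let $1\le p<\infty$, and let $\Psi_1,\Psi_2:(0,\infty)\to(0,\infty)$ be measurable functions. Suppose that there is a constant $A>0$ such that $\frac{\Psi_2(r)}{r^n}\le A\,\frac{\Psi_2(s)}{s^n}$ for all $0<s\le r$, and that there exist $c>0$ and $\delta>0$ such that $\Psi_2(t)\le c\,\Psi_1(t)$ for every $t\in(0,\delta)$. Then $S_{p,\Psi_1}\subseteq S_{p,\Psi_2}$.
   Context: For $1\le p<\infty$, a measurable function $\Psi:(0,\infty)\to(0,\infty)$ and $f\in L^p_{\rm loc}(\mathbb{R}^n)$, the Stummel $p$-modulus of $f$ is $$\eta_{p,\Psi}f(r):=\sup_{x\in\mathbb{R}^n}\left(\int_{|x-y|<r}\frac{|f(y)|^p\,\Psi(|x-y|)}{|x-y|^n}\,dy\right)^{1/p}\in[0,\infty],\quad r>0,$$ which is nondecreasing in $r$. The generalized Stummel $p$-class is $S_{p,\Psi}=S_{p,\Psi}(\mathbb{R}^n):=\{f\in L^p_{\rm loc}(\mathbb{R}^n):\ \eta_{p,\Psi}f(r)\searrow 0 \text{ as } r\searrow 0\}$, i.e. $\lim_{r\to0^+}\eta_{p,\Psi}f(r)=0$. *)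

theory Defs
  imports "HOL-Analysis.Analysis"
begin

text \<open>Elements of \<open>L\<^sup>p\<^sub>l\<^sub>o\<^sub>c\<close> are represented by functions rather than by
  classes modulo equality almost everywhere. The sort of \<open>'b\<close> admits both
  \<^typ>\<open>real\<close> and \<^typ>\<open>complex\<close> as scalars.\<close>

definition Lp_loc :: "real \<Rightarrow> (real ^ 'n \<Rightarrow> 'b::{real_normed_field,euclidean_space}) set" where
  "Lp_loc p = {f. f \<in> borel_measurable lebesgue \<and>
     (\<forall>K. compact K \<longrightarrow> set_integrable lebesgue K (\<lambda>y. norm (f y) powr p))}"

text \<open>Only used for \<open>q > 0\<close>, where \<open>\<infinity>\<^sup>q = \<infinity>\<close>.\<close>

definition ennreal_powr :: "ennreal \<Rightarrow> real \<Rightarrow> ennreal" where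
  "ennreal_powr a q = (if a = \<infinity> then \<infinity> else ennreal (enn2real a powr q))"

text \<open>A function on \<open>(0,\<infinity>)\<close> is a total function on \<^typ>\<open>real\<close> whose values outside
  \<open>(0,\<infinity>)\<close> are irrelevant. At \<open>y = x\<close> the integrand below is \<open>0\<close> because of
  division by zero, which affects only a null set.\<close>

definition stummel_modulus ::
  "real \<Rightarrow> (real \<Rightarrow> real) \<Rightarrow> (real ^ 'n \<Rightarrow> 'b::{real_normed_field,euclidean_space}) \<Rightarrow> real \<Rightarrow> ennreal"
  where
  "stummel_modulus p \<Psi> f r =
     (SUP x. ennreal_powr
        (\<integral>\<^sup>+y\<in>ball x r. ennreal (norm (f y) powr p * \<Psi> (norm (x - y)) / norm (x - y) ^ CARD('n)) \<partial>lebesgue)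
        (1 / p))"

text \<open>The modulus is nondecreasing in \<open>r\<close>, so the limit is the only condition.\<close>

definition stummel_class ::
  "real \<Rightarrow> (real \<Rightarrow> real) \<Rightarrow> (real ^ 'n \<Rightarrow> 'b::{real_normed_field,euclidean_space}) set" where
  "stummel_class p \<Psi> = {f \<in> Lp_loc p. (stummel_modulus p \<Psi> f \<longlongrightarrow> 0) (at_right 0)}"

end

theory Submission
  imports Defs
begin

text \<open>For \<open>r < \<delta>\<close> the pointwise bound \<open>\<Psi>\<^sub>2 \<le> c \<Psi>\<^sub>1\<close> on \<open>(0,r)\<close> passes to the integrals, so the
  modulus with \<open>\<Psi>\<^sub>2\<close> is at most \<open>c\<^bsup>1/p\<^esup>\<close> times the modulus with \<open>\<Psi>\<^sub>1\<close> for all small \<open>r\<close>.\<close>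

text \<open>In contrast to \<open>nn_integral_cmult\<close>, measurability of \<open>f\<close> is not assumed: the integral is a
  supremum over simple functions below the integrand, and these can be divided by \<open>c\<close>.\<close>

lemma nn_integral_cmult_le:
  fixes f :: "'a \<Rightarrow> ennreal" and c :: real
  assumes "0 < c"
  shows "(\<integral>\<^sup>+x. ennreal c * f x \<partial>M) \<le> ennreal c * (\<integral>\<^sup>+x. f x \<partial>M)"
  unfolding nn_integral_def[of M "\<lambda>x. ennreal c * f x"]
proof (rule SUP_least, clarsimp)
  fix g :: "'a \<Rightarrow> ennreal"
  assume g: "simple_function M g" and le: "g \<le> (\<lambda>x. ennreal c * f x)"
  have inv: "ennreal c * ennreal (1 / c) = 1"
    using assms by (simp add: ennreal_mult[symmetric])
  have "(\<integral>\<^sup>+x. ennreal (1 / c) * g x \<partial>M) \<le> (\<integral>\<^sup>+x. f x \<partial>M)"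
  proof (rule nn_integral_mono)
    fix x
    have "ennreal (1 / c) * g x \<le> ennreal (1 / c) * (ennreal c * f x)"
      using le by (intro mult_left_mono) (auto simp: le_fun_def)
    also have "\<dots> = f x"
      using inv by (metis mult.assoc mult.commute mult_1)
    finally show "ennreal (1 / c) * g x \<le> f x" .
  qed
  \<comment> \<open>The scalar comes out of this integral because \<open>g\<close> is simple, hence
    measurable.\<close>
  moreover have "(\<integral>\<^sup>+x. ennreal (1 / c) * g x \<partial>M) = ennreal (1 / c) * integral\<^sup>S M g"
    using g by (simp add: nn_integral_cmult borel_measurable_simple_function
        nn_integral_eq_simple_integral)
  ultimately have "ennreal c * (ennreal (1 / c) * integral\<^sup>S M g) \<le> ennreal c * (\<integral>\<^sup>+x. f x \<partial>M)"
    by (intro mult_left_mono) auto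
  then show "integral\<^sup>S M g \<le> ennreal c * (\<integral>\<^sup>+x. f x \<partial>M)"
    using inv by (simp add: mult.assoc[symmetric])
qed

lemma ennreal_powr_mono:
  assumes "a \<le> b" "0 \<le> q"
  shows "ennreal_powr a q \<le> ennreal_powr b q"
proof (cases "b = \<infinity>")
  case False
  \<comment> \<open>\<open>enn2real\<close> sends \<infinity> to 0, so it is monotone only below a
    finite bound.\<close>
  then have "a \<noteq> \<infinity>" "enn2real a \<le> enn2real b"
    using assms by (auto simp: top_unique less_top intro!: enn2real_mono)
  then show ?thesis
    using False assms by (auto simp: ennreal_powr_def intro!: ennreal_leI powr_mono2)
qed (simp add: ennreal_powr_def)

text \<open>As \<open>c\<close> and \<open>c powr q\<close> are both positive, the two sides are
  infinite together; for finite \<open>a\<close> this is multiplicativity of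
  \<open>powr\<close>.\<close>

lemma ennreal_powr_cmult:
  assumes "0 < c"
  shows "ennreal_powr (ennreal c * a) q = ennreal (c powr q) * ennreal_powr a q"
  using assms
  by (auto simp: ennreal_powr_def ennreal_mult_eq_top_iff ennreal_mult_top enn2real_mult
      powr_mult ennreal_mult)

text \<open>Comparison at one fixed radius: every distance \<open>norm (x - y)\<close> in the
  integral is below \<open>r\<close>, so a bound on the weights over the interval from 0 to
  \<open>r\<close> suffices, uniformly in \<open>x\<close>.\<close>

lemma stummel_modulus_le_cmult:
  fixes f :: "real ^ 'n \<Rightarrow> 'b::{real_normed_field,euclidean_space}" and c p r :: real
  assumes "0 \<le> p" "0 < c"
    and le: "\<And>t. 0 < t \<Longrightarrow> t < r \<Longrightarrow> \<Psi>2 t \<le> c * \<Psi>1 t"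
  shows "stummel_modulus p \<Psi>2 f r \<le> ennreal (c powr (1 / p)) * stummel_modulus p \<Psi>1 f r"
proof -
  define I where "I \<Psi> x = (\<integral>\<^sup>+y\<in>ball x r.
    ennreal (norm (f y) powr p * \<Psi> (norm (x - y)) / norm (x - y) ^ CARD('n)) \<partial>lebesgue)"
    for \<Psi> :: "real \<Rightarrow> real" and x
  have I_le: "I \<Psi>2 x \<le> ennreal c * I \<Psi>1 x" for x
  proof -
    have "I \<Psi>2 x \<le> (\<integral>\<^sup>+y. ennreal c * (ennreal (norm (f y) powr p * \<Psi>1 (norm (x - y))
        / norm (x - y) ^ CARD('n)) * indicator (ball x r) y) \<partial>lebesgue)"
      unfolding I_def
    proof (rule nn_integral_mono)
      fix y
      let ?d = "norm (x - y)" and ?a = "norm (f y) powr p"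
      have "ennreal (?a * \<Psi>2 ?d / ?d ^ CARD('n)) \<le> ennreal c * ennreal (?a * \<Psi>1 ?d / ?d ^ CARD('n))"
        if "y \<in> ball x r"
      \<comment> \<open>The assumed bound covers only positive distances. At \<open>y = x\<close>
        both quotients are 0, since \<open>CARD('n)\<close> is positive and division by zero gives
        0.\<close>
      proof (cases "y = x")
        case False
        then have "\<Psi>2 ?d \<le> c * \<Psi>1 ?d"
          using that by (intro le) (auto simp: dist_norm)
        then have "?a * \<Psi>2 ?d / ?d ^ CARD('n) \<le> ?a * (c * \<Psi>1 ?d) / ?d ^ CARD('n)"
          by (intro divide_right_mono mult_left_mono) auto
        also have "\<dots> = c * (?a * \<Psi>1 ?d / ?d ^ CARD('n))"
          by simp
        finally show ?thesis
          \<comment> \<open>The sign of \<open>\<Psi>1\<close> is open here; \<open>ennreal\<close>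
            truncates a negative quotient to 0, and the product splits because \<open>c\<close> is
            positive.\<close>
          using assms(2) by (simp add: ennreal_mult'[symmetric] ennreal_leI)
      qed (simp add: power_0_left)
      then show "ennreal (?a * \<Psi>2 ?d / ?d ^ CARD('n)) * indicator (ball x r) y
          \<le> ennreal c * (ennreal (?a * \<Psi>1 ?d / ?d ^ CARD('n)) * indicator (ball x r) y)"
        by (simp split: split_indicator)
    qed
    also have "\<dots> \<le> ennreal c * I \<Psi>1 x"
      unfolding I_def using assms(2) by (rule nn_integral_cmult_le)
    finally show ?thesis .
  qed
  have modulus: "stummel_modulus p \<Psi> f r = (SUP x. ennreal_powr (I \<Psi> x) (1 / p))" for \<Psi>
    by (simp add: stummel_modulus_def I_def)
  show ?thesis
    unfolding modulus[of \<Psi>2]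
  proof (rule SUP_least)
    fix x
    have "ennreal_powr (I \<Psi>2 x) (1 / p) \<le> ennreal_powr (ennreal c * I \<Psi>1 x) (1 / p)"
      using I_le assms(1) by (intro ennreal_powr_mono) auto
    also have "\<dots> = ennreal (c powr (1 / p)) * ennreal_powr (I \<Psi>1 x) (1 / p)"
      using assms(2) by (rule ennreal_powr_cmult)
    also have "\<dots> \<le> ennreal (c powr (1 / p)) * stummel_modulus p \<Psi>1 f r"
      unfolding modulus by (intro mult_left_mono SUP_upper) auto
    finally show "ennreal_powr (I \<Psi>2 x) (1 / p) \<le> ennreal (c powr (1 / p)) * stummel_modulus p \<Psi>1 f r" .
  qed
qed

theorem proposition3p1:
  fixes p A c \<delta> :: real and \<Psi>1 \<Psi>2 :: "real \<Rightarrow> real"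
  assumes "1 \<le> p"
    and "\<Psi>1 \<in> borel_measurable (lebesgue_on {0<..})"
    and "\<Psi>2 \<in> borel_measurable (lebesgue_on {0<..})"
    and "\<And>t. 0 < t \<Longrightarrow> 0 < \<Psi>1 t"
    and "\<And>t. 0 < t \<Longrightarrow> 0 < \<Psi>2 t"
    and "0 < A"
    and "\<And>r s. 0 < s \<Longrightarrow> s \<le> r \<Longrightarrow> \<Psi>2 r / r ^ CARD('n) \<le> A * (\<Psi>2 s / s ^ CARD('n))"
    and "0 < c" and "0 < \<delta>"
    and "\<And>t. t \<in> {0<..<\<delta>} \<Longrightarrow> \<Psi>2 t \<le> c * \<Psi>1 t"
  shows "(stummel_class p \<Psi>1 :: (real ^ 'n::finite \<Rightarrow> 'b::{real_normed_field,euclidean_space}) set)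
           \<subseteq> stummel_class p \<Psi>2"
proof
  fix f :: "real ^ 'n \<Rightarrow> 'b"
  assume "f \<in> stummel_class p \<Psi>1"
  then have f: "f \<in> Lp_loc p" "(stummel_modulus p \<Psi>1 f \<longlongrightarrow> 0) (at_right 0)"
    by (auto simp: stummel_class_def)
  let ?C = "ennreal (c powr (1 / p))"
  \<comment> \<open>Multiplication by \<open>?C\<close> preserves the limit 0 because
    \<open>?C\<close> is finite.\<close>
  have upper: "((\<lambda>r. ?C * stummel_modulus p \<Psi>1 f r) \<longlongrightarrow> 0) (at_right 0)"
    using ennreal_tendsto_cmult[OF _ f(2), of ?C] by simp
  \<comment> \<open>Below \<delta> the comparison of the weights holds on the whole range of
    distances in a ball of radius \<open>r\<close>.\<close>
  have "eventually (\<lambda>r. r < \<delta>) (at_right 0)"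
    using \<open>0 < \<delta>\<close> by (auto simp: eventually_at_right_field)
  then have "eventually (\<lambda>r. stummel_modulus p \<Psi>2 f r \<le> ?C * stummel_modulus p \<Psi>1 f r) (at_right 0)"
    by eventually_elim (use assms in \<open>auto intro!: stummel_modulus_le_cmult\<close>)
  then have "(stummel_modulus p \<Psi>2 f \<longlongrightarrow> 0) (at_right 0)"
    by (intro tendsto_sandwich[OF _ _ tendsto_const upper]) auto
  \<comment> \<open>Membership in \<open>Lp_loc p\<close> does not depend on the weight, so it
    carries over as it is.\<close>
  with f(1) show "f \<in> stummel_class p \<Psi>2"
    by (simp add: stummel_class_def)
qed

end
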